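(* Let $1\le k<n$ and let $0<\mu<\theta_1^{(k)}$. Then $$\left(\gamma_k^{(\mu)}\right)^{-1}=\frac{\mu}{\phi_k}+\sum_{i=1}^{k}\left(\frac{\mu}{\theta_i^{(k)}}\right)^2\eta_{i,k}^{(\mu)}.$$
   Context: Let $A\in\mathbb{R}^{N\times N}$ be symmetric positive definite with simple eigenvalues $\lambda_1<\dots<\lambda_N$, let $b,x_0\in\mathbb{R}^N$, and consider the conjugate gradient (CG) method in exact arithmetic: $r_0=b-Ax_0\neq 0$, $p_0=r_0$, and for $k=1,2,\dots$ $$\gamma_{k-1}=\frac{r_{k-1}^Tr_{k-1}}{p_{k-1}^TAp_{k-1}},\quad x_k=x_{k-1}+\gamma_{k-1}p_{k-1},\quad r_k=r_{k-1}-\gamma_{k-1}Ap_{k-1},\quad \delta_k=\frac{r_k^Tr_k}{r_{k-1}^Tr_{k-1}},\quad p_k=r_k+\delta_kp_{k-1}.$$ Let $n$ be the grade of $r_0$ with respect to $A$, i.e. the maximal dimension of the Krylov subspaces $\mathrm{span}\{r_0,Ar_0,\dots,A^{k-1}r_0\}$; thus $r_k\ne0$ for $k<n$. Set $\phi_k=\|r_k\|^2/\|p_k\|^2$ (Euclidean norms). Set $\alpha_1=\gamma_0^{-1}$, $\beta_j=\sqrt{\delta_j}/\gamma_{j-1}$, $\alpha_{j+1}=\frac1{\gamma_j}+\frac{\delta_j}{\gamma_{j-1}}$ for $j\ge1$ (these are the coefficients of the Lanczos algorithm applied to $A$ with starting vector $r_0$). Let $T_k$ be the $k\times k$ symmetric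 tridiagonal matrix with diagonal $\alpha_1,\dots,\alpha_k$ and off-diagonal entries $\beta_1,\dots,\beta_{k-1}$. Let $T_k=S_k\Theta_kS_k^T$ be its spectral decomposition, $S_k$ orthogonal, $\Theta_k=\mathrm{diag}(\theta_1^{(k)},\dots,\theta_k^{(k)})$, $\theta_1^{(k)}<\dots<\theta_k^{(k)}$, and let $s_{i,j}^{(k)}$ denote the entries of $S_k$. For $\mu<\theta_1^{(k)}$, set $$\eta_{i,k}^{(\mu)}=\frac{\left(\beta_ks_{k,i}^{(k)}\right)^2}{\theta_i^{(k)}-\mu},\qquad i=1,\dots,k.$$ Let $\alpha_{k+1}^{(\mu)}$ be the real number such that the $(k+1)\times(k+1)$ symmetric tridiagonal matrix $T_{k+1}^{(\mu)}$ with diagonal $\alpha_1,\dots,\alpha_k,\alpha_{k+1}^{(\mu)}$ and off-diagonal entries $\beta_1,\dots,\beta_k$ has $\mu$ as an eigenvalue. The coefficient $\gamma_k^{(\mu)}$ is defined by requiring $T_{k+1}^{(\mu)}=L_{k+1}\,\mathrm{diag}(\gamma_0^{-1},\dots,\gamma_{k-1}^{-1},(\gamma_k^{(\mu)})^{-1})\,L_{k+1}^T$, where $L_{k+1}$ is the unit lower bidiagonal matrix with subdiagonal entries $\sqrt{\delta_1},\dots,\sqrt{\delta_k}$; equivalently $\gamma_k^{(\mu)}=\left(\alpha_{k+1}^{(\mu)}-\frac{\delta_k}{\gamma_{k-1}}\right)^{-1}$. *)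

theory Defs
  imports Complex_Main "Jordan_Normal_Form.Char_Poly" "Jordan_Normal_Form.VS_Connect"
begin

definition sym_pos_def :: "nat \<Rightarrow> real mat \<Rightarrow> bool" where
  "sym_pos_def N A \<longleftrightarrow> A \<in> carrier_mat N N \<and> transpose_mat A = A \<and>
     (\<forall>v \<in> carrier_vec N. v \<noteq> 0\<^sub>v N \<longrightarrow> v \<bullet> (A *\<^sub>v v) > 0)"

(* orthogonal_mat of the matrix library only asks for pairwise orthogonal nonzero columns *)
definition orthonormal_mat :: "nat \<Rightarrow> real mat \<Rightarrow> bool" where
  "orthonormal_mat k S \<longleftrightarrow> S \<in> carrier_mat k k \<and>
     transpose_mat S * S = 1\<^sub>m k \<and> S * transpose_mat S = 1\<^sub>m k"

definition (in vec_space) krylov_space :: "'a mat \<Rightarrow> 'a vec \<Rightarrow> nat \<Rightarrow> 'a vec set" where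
  "krylov_space A v k = span ((\<lambda>i. (A ^\<^sub>m i) *\<^sub>v v) ` {..<k})"

(* the dimensions are bounded by n, so the maximum is over a finite set *)
definition (in vec_space) grade :: "'a mat \<Rightarrow> 'a vec \<Rightarrow> nat" where
  "grade A v = Max (range (\<lambda>k. vectorspace.dim class_ring (vs (krylov_space A v k))))"

(* the state is (x, r, p); once r = 0, both quotients are 0 by the convention x / 0 = 0 *)
fun cg_step :: "real mat \<Rightarrow> real vec \<times> real vec \<times> real vec \<Rightarrow> real vec \<times> real vec \<times> real vec" where
  "cg_step A (x, r, p) =
     (let c = (r \<bullet> r) / (p \<bullet> (A *\<^sub>v p));
          r' = r - c \<cdot>\<^sub>v (A *\<^sub>v p);
          d = (r' \<bullet> r') / (r \<bullet> r)
      in (x + c \<cdot>\<^sub>v p, r', r' + d \<cdot>\<^sub>v p))"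

definition cg :: "real mat \<Rightarrow> real vec \<Rightarrow> real vec \<Rightarrow> nat \<Rightarrow> real vec \<times> real vec \<times> real vec" where
  "cg A b x0 k = (cg_step A ^^ k) (x0, b - A *\<^sub>v x0, b - A *\<^sub>v x0)"

definition cg_x :: "real mat \<Rightarrow> real vec \<Rightarrow> real vec \<Rightarrow> nat \<Rightarrow> real vec" where
  "cg_x A b x0 k = fst (cg A b x0 k)"

definition cg_r :: "real mat \<Rightarrow> real vec \<Rightarrow> real vec \<Rightarrow> nat \<Rightarrow> real vec" where
  "cg_r A b x0 k = fst (snd (cg A b x0 k))"

definition cg_p :: "real mat \<Rightarrow> real vec \<Rightarrow> real vec \<Rightarrow> nat \<Rightarrow> real vec" where
  "cg_p A b x0 k = snd (snd (cg A b x0 k))"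

definition cg_gamma :: "real mat \<Rightarrow> real vec \<Rightarrow> real vec \<Rightarrow> nat \<Rightarrow> real" where
  "cg_gamma A b x0 k =
     (cg_r A b x0 k \<bullet> cg_r A b x0 k) / (cg_p A b x0 k \<bullet> (A *\<^sub>v cg_p A b x0 k))"

(* meaningful for k \<ge> 1 only *)
definition cg_delta :: "real mat \<Rightarrow> real vec \<Rightarrow> real vec \<Rightarrow> nat \<Rightarrow> real" where
  "cg_delta A b x0 k =
     (cg_r A b x0 k \<bullet> cg_r A b x0 k) / (cg_r A b x0 (k - 1) \<bullet> cg_r A b x0 (k - 1))"

(* squared Euclidean norms written as scalar products *)
definition cg_phi :: "real mat \<Rightarrow> real vec \<Rightarrow> real vec \<Rightarrow> nat \<Rightarrow> real" where
  "cg_phi A b x0 k =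
     (cg_r A b x0 k \<bullet> cg_r A b x0 k) / (cg_p A b x0 k \<bullet> cg_p A b x0 k)"

(* the Lanczos coefficients alpha_j and beta_j are indexed from j = 1 *)
definition lanczos_alpha :: "real mat \<Rightarrow> real vec \<Rightarrow> real vec \<Rightarrow> nat \<Rightarrow> real" where
  "lanczos_alpha A b x0 j =
     (if j = 1 then 1 / cg_gamma A b x0 0
      else 1 / cg_gamma A b x0 (j - 1) + cg_delta A b x0 (j - 1) / cg_gamma A b x0 (j - 2))"

definition lanczos_beta :: "real mat \<Rightarrow> real vec \<Rightarrow> real vec \<Rightarrow> nat \<Rightarrow> real" where
  "lanczos_beta A b x0 j = sqrt (cg_delta A b x0 j) / cg_gamma A b x0 (j - 1)"

(* diagonal a 1, ..., a m and off-diagonals c 1, ..., c (m - 1); matrix indices start at 0 *)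
definition sym_tridiag :: "nat \<Rightarrow> (nat \<Rightarrow> real) \<Rightarrow> (nat \<Rightarrow> real) \<Rightarrow> real mat" where
  "sym_tridiag m a c = mat m m (\<lambda>(i, j).
     if i = j then a (i + 1)
     else if j = i + 1 then c (i + 1)
     else if i = j + 1 then c (j + 1)
     else 0)"

definition lanczos_T :: "real mat \<Rightarrow> real vec \<Rightarrow> real vec \<Rightarrow> nat \<Rightarrow> real mat" where
  "lanczos_T A b x0 k = sym_tridiag k (lanczos_alpha A b x0) (lanczos_beta A b x0)"

definition eta :: "real mat \<Rightarrow> real vec \<Rightarrow> real vec \<Rightarrow> real mat \<Rightarrow> (nat \<Rightarrow> real) \<Rightarrow> nat \<Rightarrow> real \<Rightarrow> nat \<Rightarrow> real" where
  "eta A b x0 S \<theta> k \<mu> i =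
     (lanczos_beta A b x0 k * S $$ (k - 1, i - 1))\<^sup>2 / (\<theta> i - \<mu>)"

(* T_{k+1} with its last diagonal entry replaced by a *)
definition modified_T :: "real mat \<Rightarrow> real vec \<Rightarrow> real vec \<Rightarrow> nat \<Rightarrow> real \<Rightarrow> real mat" where
  "modified_T A b x0 k a =
     sym_tridiag (k + 1) ((lanczos_alpha A b x0)(k + 1 := a)) (lanczos_beta A b x0)"

definition alpha_mu :: "real mat \<Rightarrow> real vec \<Rightarrow> real vec \<Rightarrow> nat \<Rightarrow> real \<Rightarrow> real" where
  "alpha_mu A b x0 k \<mu> = (THE a. eigenvalue (modified_T A b x0 k a) \<mu>)"

(* the unit lower bidiagonal matrix L_{k+1} *)
definition cg_L :: "real mat \<Rightarrow> real vec \<Rightarrow> real vec \<Rightarrow> nat \<Rightarrow> real mat" where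
  "cg_L A b x0 k = mat (k + 1) (k + 1) (\<lambda>(i, j).
     if i = j then 1 else if i = j + 1 then sqrt (cg_delta A b x0 i) else 0)"

definition gamma_mu :: "real mat \<Rightarrow> real vec \<Rightarrow> real vec \<Rightarrow> nat \<Rightarrow> real \<Rightarrow> real" where
  "gamma_mu A b x0 k \<mu> = (THE g. g \<noteq> 0 \<and>
     modified_T A b x0 k (alpha_mu A b x0 k \<mu>) =
       cg_L A b x0 k
       * mat_diag (k + 1) (\<lambda>i. inverse (if i = k then g else cg_gamma A b x0 i))
       * transpose_mat (cg_L A b x0 k))"

end

(* By the Schur complement of T_k - mu in T_{k+1}^(mu) - mu, alpha_{k+1}^(mu) = mu + sum_i eta_{i,k}^(mu),
   and comparing last entries in the factorization gives
   1 / gamma_k^(mu) = alpha_{k+1}^(mu) - delta_k / gamma_{k-1}.  Since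
   (mu/theta)^2 / (theta - mu) = 1 / (theta - mu) - 1 / theta - mu / theta^2,
   the claim reduces to the moments e_k^T T_k^{-1} e_k and |T_k^{-1} e_k|^2.  They are read off the
   explicit solution of T_k x = e_k, whose entries are +- gamma_{k-1} |r_{k-1}| / |r_j|, together with
   |p_k|^2 = |r_k|^4 sum_{j <= k} 1 / |r_j|^2, which needs only the local orthogonality of r_{j+1} and p_j. *)
theory Submission
  imports Defs "Jordan_Normal_Form.DL_Rank"
begin

section \<open>Grade and invariant subspaces\<close>

context vec_space
begin

lemma span_closed:
  assumes "Y \<subseteq> carrier_vec n"
  shows "0\<^sub>v n \<in> span Y"
    and "u \<in> span Y \<Longrightarrow> w \<in> span Y \<Longrightarrow> u + w \<in> span Y"
    and "w \<in> span Y \<Longrightarrow> c \<cdot>\<^sub>v w \<in> span Y"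
proof -
  have "submodule class_ring (span Y) V"
    using assms by (intro span_is_submodule) simp
  then show "0\<^sub>v n \<in> span Y"
    and "u \<in> span Y \<Longrightarrow> w \<in> span Y \<Longrightarrow> u + w \<in> span Y"
    and "w \<in> span Y \<Longrightarrow> c \<cdot>\<^sub>v w \<in> span Y"
    unfolding submodule_def by (auto simp: module_vec_simps)
qed

text \<open>Taken as a vector space of its own, \<open>span Y\<close> is generated by the possibly
  dependent set \<open>Y\<close>, so its dimension is at most \<open>card Y\<close>, and that of its
  subspace \<open>span X\<close> is no larger.\<close>

lemma dim_span_le_card:
  assumes X: "finite X" "X \<subseteq> carrier_vec n" and Y: "finite Y" "Y \<subseteq> carrier_vec n"
    and sub: "X \<subseteq> span Y"
  shows "vectorspace.dim class_ring (vs (span X)) \<le> card Y"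
proof -
  have sX: "VectorSpace.subspace class_ring (span X) V" and sY: "VectorSpace.subspace class_ring (span Y) V"
    using X Y by (auto intro!: span_is_subspace)
  have submod: "submodule class_ring (span Y) V"
    using sY by (simp add: VectorSpace.subspace_def)
  have "span X \<subseteq> span Y"
    using span_is_subset[OF sub submod] .
  then have sXY: "VectorSpace.subspace class_ring (span X) (vs (span Y))"
    by (rule nested_subspaces[OF sY sX])
  interpret W: vectorspace class_ring "vs (span Y)"
    using sY by (rule subspace_is_vs)
  have YW: "Y \<subseteq> span Y"
    using Y(2) by (intro in_own_span) simp
  have gen: "LinearCombinations.module.span class_ring (vs (span Y)) Y = span Y"
    using span_li_not_depend(1)[OF YW submod] .
  have "W.dim \<le> card Y"
    using W.gen_ge_dim[OF Y(1)] YW gen by simp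
  moreover have "W.fin_dim"
    using Y YW gen unfolding W.fin_dim_def by auto
  moreover have "vectorspace.fin_dim class_ring (vs (span X))"
    using fin_dim_span[of X] X by simp
  ultimately show ?thesis
    using W.subspace_dim[OF sXY] by simp
qed

text \<open>An invariant space that contains \<open>v\<close> contains every Krylov space of
  \<open>v\<close>, so the size of a generating set bounds all their dimensions at once.\<close>

lemma grade_le_card:
  assumes A: "A \<in> carrier_mat n n" and Y: "finite Y" "Y \<subseteq> carrier_vec n"
    and v: "v \<in> span Y" and inv: "\<And>y. y \<in> Y \<Longrightarrow> A *\<^sub>v y \<in> span Y"
  shows "grade A v \<le> card Y"
proof -
  have span_carrier: "span Y \<subseteq> carrier_vec n"
    using span_is_subset2[of Y] Y(2) by simp
  note zero = span_closed(1)[OF Y(2)] and add = span_closed(2)[OF Y(2)]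
    and smult = span_closed(3)[OF Y(2)]
  \<comment> \<open>The preimage of \<open>span Y\<close> under \<open>A\<close> is a submodule.
    Since it contains \<open>Y\<close>, it contains \<open>span Y\<close>, which carries invariance
    from the generators to the whole span.\<close>
  let ?H = "{w \<in> carrier_vec n. A *\<^sub>v w \<in> span Y}"
  have "A *\<^sub>v 0\<^sub>v n = 0\<^sub>v n"
    using A by auto
  then have "submodule class_ring ?H V"
    using A zero add smult module_axioms unfolding submodule_def
    by (auto simp: module_vec_simps mult_add_distrib_mat_vec[OF A] mult_mat_vec[OF A])
  moreover have "Y \<subseteq> ?H"
    using Y inv by auto
  ultimately have H: "span Y \<subseteq> ?H"
    by (intro span_is_subset)
  have pow: "A ^\<^sub>m i *\<^sub>v w \<in> span Y" if "w \<in> span Y" for i w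
    using that
  proof (induction i arbitrary: w)
    case 0
    then show ?case using A span_carrier by auto
  next
    case (Suc i)
    have "w \<in> carrier_vec n" "A *\<^sub>v w \<in> span Y" using Suc.prems H by auto
    then show ?case
      using A Suc.IH by (simp add: assoc_mult_mat_vec[of _ n n])
  qed
  have le: "vectorspace.dim class_ring (vs (krylov_space A v k)) \<le> card Y" for k
    unfolding krylov_space_def using pow[OF v] span_carrier
    by (intro dim_span_le_card Y) auto
  \<comment> \<open>\<open>Max\<close> is meaningful only on a finite set; the uniform bound
    \<open>le\<close> provides the finiteness.\<close>
  have "finite (range (\<lambda>k. vectorspace.dim class_ring (vs (krylov_space A v k))))"
    by (rule finite_subset[of _ "{..card Y}"]) (use le in auto)
  then show ?thesis
    unfolding grade_def by (intro Max.boundedI) (use le in auto)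
qed

end

section \<open>Spectral decompositions and bordered tridiagonal matrices\<close>

lemma real_scalar_prod_self:
  fixes x :: "real vec"
  shows "0 \<le> x \<bullet> x" and "x \<bullet> x = 0 \<longleftrightarrow> x = 0\<^sub>v (dim_vec x)"
proof -
  show "0 \<le> x \<bullet> x" by (auto simp: scalar_prod_def intro!: sum_nonneg)
  have "x \<bullet> x = 0 \<longleftrightarrow> (\<forall>i<dim_vec x. x $ i = 0)"
    unfolding scalar_prod_def by (subst sum_nonneg_eq_0_iff) auto
  then show "x \<bullet> x = 0 \<longleftrightarrow> x = 0\<^sub>v (dim_vec x)" by (metis eq_vecI index_zero_vec)
qed

lemma norm_orthonormal_mat_mult:
  assumes S: "orthonormal_mat k S" and z: "z \<in> carrier_vec k"
  shows "(S *\<^sub>v z) \<bullet> (S *\<^sub>v z) = z \<bullet> z"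
proof -
  have Sc: "S \<in> carrier_mat k k" and SS: "transpose_mat S * S = 1\<^sub>m k"
    using S by (auto simp: orthonormal_mat_def)
  have "(S *\<^sub>v z) \<bullet> (S *\<^sub>v z) = (transpose_mat S *\<^sub>v (S *\<^sub>v z)) \<bullet> z"
    using transpose_vec_mult_scalar[OF Sc z, of "S *\<^sub>v z"] Sc z by simp
  also have "transpose_mat S *\<^sub>v (S *\<^sub>v z) = z"
    using assoc_mult_mat_vec[of "transpose_mat S" k k S k z] Sc z SS by simp
  finally show ?thesis .
qed

text \<open>Here \<open>z\<close> holds coordinates in the eigenbasis, where the matrix acts
  diagonally. Splitting off the multiple by \<open>\<mu>\<close> expresses the shifted matrix
  without ever forming it.\<close>

lemma spectral_shift_mult:
  assumes S: "orthonormal_mat k S" and z: "z \<in> carrier_vec k"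
  shows "(S * mat_diag k d * transpose_mat S) *\<^sub>v (S *\<^sub>v z) =
    \<mu> \<cdot>\<^sub>v (S *\<^sub>v z) + S *\<^sub>v vec k (\<lambda>i. (d i - \<mu>) * z $ i)"
proof -
  have Sc: "S \<in> carrier_mat k k" and SS: "transpose_mat S * S = 1\<^sub>m k"
    using S by (auto simp: orthonormal_mat_def)
  have "mat_diag k d *\<^sub>v z = vec k (\<lambda>i. d i * z $ i)"
    using z by (auto simp: mat_diag_def scalar_prod_def if_distrib[of "\<lambda>x. x * _"] cong: if_cong)
  also have "\<dots> = \<mu> \<cdot>\<^sub>v z + vec k (\<lambda>i. (d i - \<mu>) * z $ i)"
    using z by (auto simp: algebra_simps)
  finally have D: "mat_diag k d *\<^sub>v z = \<mu> \<cdot>\<^sub>v z + vec k (\<lambda>i. (d i - \<mu>) * z $ i)" .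
  have "transpose_mat S *\<^sub>v (S *\<^sub>v z) = z"
    using assoc_mult_mat_vec[of "transpose_mat S" k k S k z] Sc z SS by simp
  then have "(S * mat_diag k d * transpose_mat S) *\<^sub>v (S *\<^sub>v z) = S *\<^sub>v (mat_diag k d *\<^sub>v z)"
    using Sc z assoc_mult_mat_vec[of "S * mat_diag k d" k k "transpose_mat S" k "S *\<^sub>v z"]
      assoc_mult_mat_vec[of S k k "mat_diag k d" k z] by simp
  then show ?thesis
    unfolding D using Sc z by (simp add: mult_add_distrib_mat_vec[of _ k k] mult_mat_vec[of _ k k])
qed

text \<open>Row \<open>m\<close> of \<open>S\<close> is the coordinate vector of
  \<open>unit_vec k m\<close> with respect to the columns of \<open>S\<close>.\<close>

lemma orthonormal_mat_row:
  assumes S: "orthonormal_mat k S" and m: "m < k"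
  shows "S *\<^sub>v (c \<cdot>\<^sub>v row S m) = c \<cdot>\<^sub>v unit_vec k m"
proof -
  have Sc: "S \<in> carrier_mat k k" and SS: "S * transpose_mat S = 1\<^sub>m k"
    using S by (auto simp: orthonormal_mat_def)
  have "S *\<^sub>v row S m = col (S * transpose_mat S) m"
    using Sc m by auto
  then show ?thesis
    unfolding SS using Sc m by (simp add: mult_mat_vec[of _ k k])
qed

lemma spectral_resolvent_exists:
  assumes S: "orthonormal_mat k S" and m: "m < k" and d: "\<And>i. i < k \<Longrightarrow> d i \<noteq> \<mu>"
  obtains x where "x \<in> carrier_vec k"
    "(S * mat_diag k d * transpose_mat S) *\<^sub>v x = \<mu> \<cdot>\<^sub>v x + c \<cdot>\<^sub>v unit_vec k m"
proof
  have Sc: "S \<in> carrier_mat k k" using S by (simp add: orthonormal_mat_def)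
  let ?z = "vec k (\<lambda>i. c * S $$ (m, i) / (d i - \<mu>))"
  show "S *\<^sub>v ?z \<in> carrier_vec k" using Sc by simp
  have "vec k (\<lambda>i. (d i - \<mu>) * ?z $ i) = c \<cdot>\<^sub>v row S m"
    using Sc m d by auto
  then show "(S * mat_diag k d * transpose_mat S) *\<^sub>v (S *\<^sub>v ?z) = \<mu> \<cdot>\<^sub>v (S *\<^sub>v ?z) + c \<cdot>\<^sub>v unit_vec k m"
    using spectral_shift_mult[OF S, of ?z d \<mu>] orthonormal_mat_row[OF S m] by simp
qed

text \<open>The equation says that \<open>x\<close> is \<open>c\<close> times the resolvent at
  \<open>\<mu>\<close> applied to \<open>unit_vec k m\<close>, so its eigenbasis coordinates are
  \<open>c * S $$ (m, i) / (d i - \<mu>)\<close>. The shift \<open>\<mu>\<close> serves the bordered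
  matrix, the shift 0 the moments of the inverse.\<close>

lemma spectral_resolvent:
  assumes S: "orthonormal_mat k S" and m: "m < k" and d: "\<And>i. i < k \<Longrightarrow> d i \<noteq> \<mu>"
    and x: "x \<in> carrier_vec k"
    and eq: "(S * mat_diag k d * transpose_mat S) *\<^sub>v x = \<mu> \<cdot>\<^sub>v x + c \<cdot>\<^sub>v unit_vec k m"
  shows "x $ m = c * (\<Sum>i<k. (S $$ (m, i))\<^sup>2 / (d i - \<mu>))"
    and "x \<bullet> x = c\<^sup>2 * (\<Sum>i<k. (S $$ (m, i))\<^sup>2 / (d i - \<mu>)\<^sup>2)"
proof -
  have Sc: "S \<in> carrier_mat k k" and SS: "S * transpose_mat S = 1\<^sub>m k"
    and SS': "transpose_mat S * S = 1\<^sub>m k"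
    using S by (auto simp: orthonormal_mat_def)
  define z where "z = transpose_mat S *\<^sub>v x"
  have zc: "z \<in> carrier_vec k" using Sc x by (simp add: z_def)
  have xz: "x = S *\<^sub>v z"
    using assoc_mult_mat_vec[of S k k "transpose_mat S" k x] Sc x SS by (simp add: z_def)
  have inj: "u = w" if "S *\<^sub>v u = S *\<^sub>v w" "u \<in> carrier_vec k" "w \<in> carrier_vec k" for u w
    using arg_cong[OF that(1), of "\<lambda>y. transpose_mat S *\<^sub>v y"] that(2,3) Sc SS'
    by (simp flip: assoc_mult_mat_vec[of _ k k _ k])
  let ?y = "vec k (\<lambda>i. (d i - \<mu>) * z $ i)"
  have Seq0: "\<mu> \<cdot>\<^sub>v x + S *\<^sub>v ?y = \<mu> \<cdot>\<^sub>v x + S *\<^sub>v (c \<cdot>\<^sub>v row S m)"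
    using eq spectral_shift_mult[OF S zc, of d \<mu>] orthonormal_mat_row[OF S m, of c]
    by (simp flip: xz)
  have Seq: "S *\<^sub>v ?y = S *\<^sub>v (c \<cdot>\<^sub>v row S m)"
  proof (intro eq_vecI)
    fix i assume "i < dim_vec (S *\<^sub>v (c \<cdot>\<^sub>v row S m))"
    then show "(S *\<^sub>v ?y) $ i = (S *\<^sub>v (c \<cdot>\<^sub>v row S m)) $ i"
      using arg_cong[OF Seq0, of "\<lambda>v. v $ i"] Sc x by (simp del: index_mult_mat_vec)
  qed (use Sc in simp)
  have "?y = c \<cdot>\<^sub>v row S m"
    using Seq by (rule inj) (use Sc m in auto)
  then have "(d i - \<mu>) * z $ i = c * S $$ (m, i)" if "i < k" for i
    using that Sc m by (auto dest!: arg_cong[of _ _ "\<lambda>v. v $ i"])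
  then have zi: "z $ i = c * S $$ (m, i) / (d i - \<mu>)" if "i < k" for i
    using that d by (simp add: field_simps)
  have "x $ m = (\<Sum>i<k. S $$ (m, i) * z $ i)"
    using Sc zc m by (simp add: xz scalar_prod_def atLeast0LessThan)
  also have "\<dots> = c * (\<Sum>i<k. (S $$ (m, i))\<^sup>2 / (d i - \<mu>))"
    unfolding sum_distrib_left by (rule sum.cong) (auto simp: zi power2_eq_square)
  finally show "x $ m = \<dots>" .
  have "x \<bullet> x = (\<Sum>i<k. z $ i * z $ i)"
    using norm_orthonormal_mat_mult[OF S zc] zc by (simp add: xz scalar_prod_def atLeast0LessThan)
  also have "\<dots> = c\<^sup>2 * (\<Sum>i<k. (S $$ (m, i))\<^sup>2 / (d i - \<mu>)\<^sup>2)"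
    unfolding sum_distrib_left by (rule sum.cong) (auto simp: zi power2_eq_square)
  finally show "x \<bullet> x = \<dots>" .
qed

section \<open>Tridiagonal matrices and their bordering\<close>

lemma sym_tridiag_carrier [simp]: "sym_tridiag m a c \<in> carrier_mat m m"
  by (simp add: sym_tridiag_def)

lemma sym_tridiag_mult_vec:
  assumes x: "x \<in> carrier_vec m" and i: "i < m"
  shows "(sym_tridiag m a c *\<^sub>v x) $ i = (if 0 < i then c i * x $ (i - 1) else 0)
    + a (Suc i) * x $ i + (if Suc i < m then c (Suc i) * x $ Suc i else 0)"
proof -
  have "(sym_tridiag m a c *\<^sub>v x) $ i = (\<Sum>j<m. sym_tridiag m a c $$ (i, j) * x $ j)"
    using x i by (simp add: sym_tridiag_def scalar_prod_def atLeast0LessThan)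
  \<comment> \<open>In row 0 the truncated \<open>i - 1\<close> coincides with \<open>i\<close>, so
    the guard \<open>0 < i\<close> must remove the first term. In the last row \<open>Suc i\<close>
    lies outside the range of summation.\<close>
  also have "\<dots> = (\<Sum>j<m.
      (if j = i - 1 then if 0 < i then c i * x $ (i - 1) else 0 else 0)
      + (if j = i then a (Suc i) * x $ i else 0)
      + (if j = Suc i then c (Suc i) * x $ Suc i else 0))"
    using i by (intro sum.cong) (auto simp: sym_tridiag_def)
  finally show ?thesis
    using i by (simp add: sum.distrib less_imp_diff_less)
qed

text \<open>Block elimination on an eigenvector \<open>v\<close>: the first \<open>k\<close> rows
  determine its upper part through the resolvent, and inserting this into the last row leaves a
  scalar equation for \<open>a\<close>. The equivalence yields both existence and uniqueness for the
  \<open>THE\<close> in \<open>alpha_mu\<close>.\<close>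

lemma eigenvalue_bordered_tridiag_iff:
  assumes S: "orthonormal_mat k S" and k: "k = Suc m"
    and T: "sym_tridiag k al be = S * mat_diag k d * transpose_mat S"
    and d: "\<And>i. i < k \<Longrightarrow> d i \<noteq> \<mu>"
  shows "eigenvalue (sym_tridiag (Suc k) (al(Suc k := a)) be) \<mu> \<longleftrightarrow>
    a = \<mu> + (\<Sum>i<k. (be k * S $$ (m, i))\<^sup>2 / (d i - \<mu>))"
    (is "eigenvalue ?M \<mu> \<longleftrightarrow> a = \<mu> + ?E")
proof -
  have E: "?E = (be k)\<^sup>2 * (\<Sum>i<k. (S $$ (m, i))\<^sup>2 / (d i - \<mu>))"
    by (simp add: sum_distrib_left power_mult_distrib)
  \<comment> \<open>The border touches the first \<open>k\<close> rows only in row \<open>m\<close>,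
    where \<open>be k\<close> multiplies the last coordinate.\<close>
  have Mv: "(?M *\<^sub>v v) $ i = (sym_tridiag k al be *\<^sub>v vec k (($) v)
      + (be k * v $ k) \<cdot>\<^sub>v unit_vec k m) $ i"
    if "v \<in> carrier_vec (Suc k)" "i < k" for v i
    using that by (auto simp: sym_tridiag_mult_vec k less_Suc_eq less_imp_diff_less simp del: index_mult_mat_vec vec_Suc)
  have Mk: "(?M *\<^sub>v v) $ k = be k * v $ m + a * v $ k" if "v \<in> carrier_vec (Suc k)" for v
    using that by (simp add: sym_tridiag_mult_vec k del: index_mult_mat_vec)
  have m: "m < k" by (simp add: k)
  show ?thesis
  proof
    assume "eigenvalue ?M \<mu>"
    then obtain v where v: "v \<in> carrier_vec (Suc k)" "v \<noteq> 0\<^sub>v (Suc k)" "?M *\<^sub>v v = \<mu> \<cdot>\<^sub>v v"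
      by (auto simp: eigenvalue_def eigenvector_def sym_tridiag_def)
    define u where "u = vec k (($) v)"
    have uc: "u \<in> carrier_vec k" by (simp add: u_def)
    have "sym_tridiag k al be *\<^sub>v u = \<mu> \<cdot>\<^sub>v u + (- be k * v $ k) \<cdot>\<^sub>v unit_vec k m"
    proof (rule eq_vecI)
      show "dim_vec (sym_tridiag k al be *\<^sub>v u) = dim_vec (\<mu> \<cdot>\<^sub>v u + (- be k * v $ k) \<cdot>\<^sub>v unit_vec k m)"
        by (simp add: sym_tridiag_def)
      fix i assume "i < dim_vec (\<mu> \<cdot>\<^sub>v u + (- be k * v $ k) \<cdot>\<^sub>v unit_vec k m)"
      then have i: "i < k" by simp
      have "(sym_tridiag k al be *\<^sub>v u) $ i + (be k * v $ k) * unit_vec k m $ i = \<mu> * u $ i"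
        using Mv[OF v(1) i] v(1,3) i by (simp add: u_def sym_tridiag_def del: index_mult_mat_vec)
      then show "(sym_tridiag k al be *\<^sub>v u) $ i
          = (\<mu> \<cdot>\<^sub>v u + (- be k * v $ k) \<cdot>\<^sub>v unit_vec k m) $ i"
        using i uc by (simp del: index_mult_mat_vec)
    qed
    note res = spectral_resolvent[OF S m d uc this[unfolded T]]
    \<comment> \<open>With last coordinate 0 the upper part would solve the homogeneous shifted
      equation; as \<open>\<mu>\<close> avoids every \<open>d i\<close>, it would vanish, and so
      would \<open>v\<close>.\<close>
    have "v $ k \<noteq> 0"
    proof
      assume 0: "v $ k = 0"
      then have "u \<bullet> u = 0" using res(2) by simp
      then have "u = 0\<^sub>v k"
        using uc real_scalar_prod_self(2)[of u] by simp
      have "v = 0\<^sub>v (Suc k)"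
      proof (rule eq_vecI)
        fix i assume "i < dim_vec (0\<^sub>v (Suc k) :: real vec)"
        then show "v $ i = 0\<^sub>v (Suc k) $ i"
          using 0 arg_cong[OF \<open>u = 0\<^sub>v k\<close>, of "\<lambda>w. w $ i"] by (cases "i = k") (auto simp: u_def)
      qed (use v in simp)
      with v show False by simp
    qed
    have um: "u $ m = v $ m" by (simp add: u_def m)
    have "be k * v $ m + a * v $ k = \<mu> * v $ k"
      using Mk[OF v(1)] v(1,3) by simp
    then have "(\<mu> + ?E) * v $ k = a * v $ k"
      using res(1) unfolding um E by (simp add: algebra_simps power2_eq_square)
    then show "a = \<mu> + ?E" using \<open>v $ k \<noteq> 0\<close> by simp
  next
    assume a: "a = \<mu> + ?E"
    obtain x where x: "x \<in> carrier_vec k"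
      "sym_tridiag k al be *\<^sub>v x = \<mu> \<cdot>\<^sub>v x + (- be k) \<cdot>\<^sub>v unit_vec k m"
      using spectral_resolvent_exists[OF S m, of d \<mu> "- be k"] d unfolding T by blast
    note res = spectral_resolvent(1)[OF S m d x(1) x(2)[unfolded T]]
    \<comment> \<open>The eigenvector is normalized to last coordinate 1; its upper part is then
      forced to be \<open>x\<close>.\<close>
    define v where "v = vec (Suc k) (\<lambda>i. if i < k then x $ i else 1)"
    have v: "v \<in> carrier_vec (Suc k)" by (simp add: v_def)
    have vx: "vec k (($) v) = x" using x by (auto simp: v_def)
    have "?M *\<^sub>v v = \<mu> \<cdot>\<^sub>v v"
    proof (rule eq_vecI)
      fix i assume "i < dim_vec (\<mu> \<cdot>\<^sub>v v)"
      then consider "i < k" | "i = k" using v by fastforce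
      then show "(?M *\<^sub>v v) $ i = (\<mu> \<cdot>\<^sub>v v) $ i"
      proof cases
        case 1
        then show ?thesis
          using x(1) unfolding Mv[OF v 1] vx x(2) by (simp add: v_def)
      next
        case 2
        have "be k * x $ m + a = \<mu>"
          using res unfolding a E by (simp add: algebra_simps power2_eq_square)
        then show ?thesis
          unfolding 2 Mk[OF v] using m by (simp add: v_def)
      qed
    qed (use v in \<open>simp add: sym_tridiag_def\<close>)
    moreover have "v $ k \<noteq> 0\<^sub>v (Suc k) $ k" by (simp add: v_def)
    then have "v \<noteq> 0\<^sub>v (Suc k)" by metis
    ultimately show "eigenvalue ?M \<mu>"
      using v by (auto simp: eigenvalue_def eigenvector_def sym_tridiag_def)
  qed
qed

section \<open>The conjugate gradient iteration\<close>

locale cg_iteration =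
  fixes N :: nat and A :: "real mat" and b x0 :: "real vec"
  assumes spd: "sym_pos_def N A" and b: "b \<in> carrier_vec N" and x0: "x0 \<in> carrier_vec N"
begin

abbreviation "r \<equiv> cg_r A b x0"
abbreviation "p \<equiv> cg_p A b x0"
abbreviation "\<gamma> \<equiv> cg_gamma A b x0"
abbreviation "\<delta> \<equiv> cg_delta A b x0"
abbreviation "\<rho> j \<equiv> r j \<bullet> r j"

section \<open>Recurrences, local orthogonality and positivity of the coefficients\<close>

lemma A_carrier: "A \<in> carrier_mat N N"
  using spd by (simp add: sym_pos_def_def)

lemma r_0: "r 0 = b - A *\<^sub>v x0" and p_0: "p 0 = r 0"
  by (simp_all add: cg_r_def cg_p_def cg_def)

lemma r_Suc: "r (Suc j) = r j - \<gamma> j \<cdot>\<^sub>v (A *\<^sub>v p j)"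
  by (cases "cg A b x0 j") (auto simp: cg_r_def cg_p_def cg_gamma_def cg_def Let_def)

lemma p_Suc: "p (Suc j) = r (Suc j) + \<delta> (Suc j) \<cdot>\<^sub>v p j"
  by (cases "cg A b x0 j") (auto simp: cg_r_def cg_p_def cg_delta_def cg_def Let_def)

lemma r_p_carrier: "r j \<in> carrier_vec N \<and> p j \<in> carrier_vec N"
proof (induction j)
  case 0
  then show ?case using A_carrier b x0 by (simp add: r_0 p_0)
next
  case (Suc j)
  then show ?case using A_carrier by (simp add: r_Suc p_Suc)
qed

lemmas r_carrier = r_p_carrier[THEN conjunct1] and p_carrier = r_p_carrier[THEN conjunct2]

lemma Ap_carrier: "A *\<^sub>v p j \<in> carrier_vec N"
  using A_carrier p_carrier by simp

lemma p_A_p_pos: "p j \<noteq> 0\<^sub>v N \<Longrightarrow> 0 < p j \<bullet> (A *\<^sub>v p j)"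
  using spd p_carrier by (simp add: sym_pos_def_def)

text \<open>The step length \<open>\<gamma> j\<close> is the one that cancels the component of the
  new residual along \<open>p j\<close>. The hypothesis is \<open>p_dot_r\<close> at
  \<open>j\<close>, whose induction uses this lemma; \<open>p j = 0\<close> is split off because the
  denominator of \<open>\<gamma> j\<close> then vanishes.\<close>

lemma r_Suc_orth_aux: "p j \<bullet> r j = \<rho> j \<Longrightarrow> p j \<bullet> r (Suc j) = 0"
proof (cases "p j = 0\<^sub>v N")
  case True
  then show ?thesis using r_carrier[of "Suc j"] by simp
next
  case False
  assume "p j \<bullet> r j = \<rho> j"
  then show ?thesis
    using p_A_p_pos[OF False] scalar_prod_minus_distrib[OF p_carrier[of j] r_carrier[of j], of "\<gamma> j \<cdot>\<^sub>v (A *\<^sub>v p j)"]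
      Ap_carrier[of j] p_carrier[of j]
    by (simp add: r_Suc cg_gamma_def)
qed

lemma p_dot_r: "p j \<bullet> r j = \<rho> j"
proof (induction j)
  case 0
  then show ?case by (simp add: p_0)
next
  case (Suc j)
  then show ?case
    using r_Suc_orth_aux[OF Suc] r_carrier[of "Suc j"] p_carrier[of j]
    unfolding p_Suc by (simp add: add_scalar_prod_distrib[of _ N])
qed

lemma p_dot_r_Suc: "p j \<bullet> r (Suc j) = 0"
  by (rule r_Suc_orth_aux[OF p_dot_r])

lemma rho_nonneg: "0 \<le> \<rho> j"
  by (rule real_scalar_prod_self(1))

lemma rho_pos: "r j \<noteq> 0\<^sub>v N \<Longrightarrow> 0 < \<rho> j"
  using real_scalar_prod_self[of "r j"] r_carrier[of j] by (simp add: less_le)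

lemma p_nonzero: "r j \<noteq> 0\<^sub>v N \<Longrightarrow> p j \<noteq> 0\<^sub>v N"
  using rho_pos[of j] p_dot_r[of j] r_carrier[of j] by auto

lemma gamma_pos: "r j \<noteq> 0\<^sub>v N \<Longrightarrow> 0 < \<gamma> j"
  unfolding cg_gamma_def by (intro divide_pos_pos rho_pos p_A_p_pos p_nonzero)

lemma delta_nonneg: "0 \<le> \<delta> j"
  unfolding cg_delta_def by (intro divide_nonneg_nonneg rho_nonneg)

lemma delta_Suc: "\<delta> (Suc j) = \<rho> (Suc j) / \<rho> j"
  by (simp add: cg_delta_def)

text \<open>By orthogonality of \<open>p k\<close> and \<open>r (Suc k)\<close>, the squared norm of
  \<open>p (Suc k)\<close> is \<open>\<rho> (Suc k)\<close> plus
  \<open>(\<delta> (Suc k))\<^sup>2\<close> times that of \<open>p k\<close>. Divided by the square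
  of \<open>\<rho>\<close>, it thus grows by \<open>1 / \<rho> (Suc k)\<close> in each step.\<close>

lemma p_norm:
  assumes "\<And>j. j \<le> k \<Longrightarrow> r j \<noteq> 0\<^sub>v N"
  shows "p k \<bullet> p k = (\<rho> k)\<^sup>2 * (\<Sum>j\<le>k. 1 / \<rho> j)"
  using assms
proof (induction k)
  case 0
  then show ?case by (simp add: p_0 power2_eq_square)
next
  case (Suc k)
  have pos: "0 < \<rho> k" "0 < \<rho> (Suc k)" using Suc.prems by (auto intro: rho_pos)
  have "p (Suc k) \<bullet> p (Suc k) = \<rho> (Suc k) + \<delta> (Suc k) * (p k \<bullet> p (Suc k))"
    unfolding p_Suc[of k]
    using r_carrier[of "Suc k"] p_carrier[of k] p_dot_r_Suc[of k]
    by (simp add: add_scalar_prod_distrib[of _ N] scalar_prod_add_distrib[of _ N]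
        comm_scalar_prod[of "r (Suc k)" N "p k"])
  also have "p k \<bullet> p (Suc k) = \<delta> (Suc k) * (p k \<bullet> p k)"
    unfolding p_Suc[of k]
    using r_carrier[of "Suc k"] p_carrier[of k] p_dot_r_Suc[of k]
    by (simp add: scalar_prod_add_distrib[of _ N])
  also have "p k \<bullet> p k = (\<rho> k)\<^sup>2 * (\<Sum>j\<le>k. 1 / \<rho> j)"
    using Suc by simp
  finally show ?case
    using pos by (simp add: delta_Suc field_simps power2_eq_square)
qed

text \<open>The summand of \<open>p_norm\<close> with the largest index becomes the 1; the remaining
  sum is the one in the squared norm in \<open>lanczos_T_solution\<close>.\<close>

lemma inverse_phi:
  assumes "\<And>j. j \<le> Suc m \<Longrightarrow> r j \<noteq> 0\<^sub>v N"
  shows "1 / cg_phi A b x0 (Suc m) = 1 + \<rho> (Suc m) * (\<Sum>j\<le>m. 1 / \<rho> j)"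
  using p_norm[of "Suc m", OF assms] rho_pos[of "Suc m"] assms
  by (simp add: cg_phi_def field_simps power2_eq_square)

text \<open>Once the residual vanishes, the search directions found so far span an invariant subspace.\<close>

lemma r_nonzero:
  assumes "j < vec_space.grade N A (r 0)"
  shows "r j \<noteq> 0\<^sub>v N"
proof
  interpret vec_space "TYPE(real)" N .
  assume "r j = 0\<^sub>v N"
  \<comment> \<open>At the first vanishing residual all earlier \<open>\<gamma> i\<close> are
    positive, and only \<open>l\<close> directions are needed, with \<open>l\<close> at most
    \<open>j\<close> and hence below the grade.\<close>
  define l where "l = (LEAST i. r i = 0\<^sub>v N)"
  have l0: "r l = 0\<^sub>v N" and lj: "l \<le> j"
    unfolding l_def using \<open>r j = 0\<^sub>v N\<close> by (auto intro: LeastI Least_le)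
  have nz: "r i \<noteq> 0\<^sub>v N" if "i < l" for i
    using not_less_Least[of i "\<lambda>i. r i = 0\<^sub>v N"] that by (simp add: l_def)
  let ?Y = "p ` {..<l}"
  have Y: "finite ?Y" "?Y \<subseteq> carrier_vec N" using p_carrier by auto
  note zero = span_closed(1)[OF Y(2)] and add = span_closed(2)[OF Y(2)]
    and smult = span_closed(3)[OF Y(2)]
  have p_span: "p i \<in> span ?Y" if "i < l" for i
    using that in_own_span[of ?Y] Y(2) by auto
  have r_span: "r i \<in> span ?Y" if "i \<le> l" for i
  proof (cases "i = l")
    case True
    then show ?thesis using l0 zero by simp
  next
    case False
    then have i: "i < l" using that by simp
    show ?thesis
    proof (cases i)
      case 0
      then show ?thesis using p_span[OF i] by (simp add: p_0)
    next
      case (Suc i')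
      have "r i = p i + (- \<delta> i) \<cdot>\<^sub>v p i'"
        using p_Suc[of i'] r_carrier[of i] p_carrier[of i'] by (auto simp: Suc)
      then show ?thesis using add smult p_span i Suc by simp
    qed
  qed
  have "A *\<^sub>v p i \<in> span ?Y" if i: "i < l" for i
  proof -
    \<comment> \<open>The residual recurrence is solved for \<open>A *\<^sub>v p i\<close>. For the
      last direction the new residual is \<open>r l\<close>, which is zero and hence in the
      span.\<close>
    have "A *\<^sub>v p i = (1 / \<gamma> i) \<cdot>\<^sub>v (r i + (-1) \<cdot>\<^sub>v r (Suc i))"
      using gamma_pos[OF nz[OF i]] r_carrier[of i] Ap_carrier[of i] A_carrier
      by (auto simp: r_Suc simp del: index_mult_mat_vec)
    then show ?thesis using add smult r_span i by simp
  qed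
  then have "grade A (r 0) \<le> card ?Y"
    by (intro grade_le_card A_carrier Y r_span) auto
  also have "\<dots> \<le> l" using card_image_le[of "{..<l}" p] by simp
  finally show False using assms lj by simp
qed

section \<open>The Lanczos matrix and the last column of its inverse\<close>

lemma alpha_Suc: "lanczos_alpha A b x0 (Suc i) =
    1 / \<gamma> i + (if 0 < i then \<delta> i / \<gamma> (i - 1) else 0)"
  by (auto simp: lanczos_alpha_def numeral_2_eq_2)

lemma beta_Suc: "lanczos_beta A b x0 (Suc i) = sqrt (\<delta> (Suc i)) / \<gamma> i"
  by (simp add: lanczos_beta_def)

text \<open>The solution comes from the factorization \<open>T = L D L\<^sup>T\<close>: it is \<open>\<gamma> m\<close> times the
  last column of the inverse of \<open>L\<^sup>T\<close>.\<close>

lemma lanczos_T_solution: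
  assumes nz: "\<And>j. j \<le> m \<Longrightarrow> r j \<noteq> 0\<^sub>v N"
  defines "x \<equiv> vec (Suc m) (\<lambda>j. \<gamma> m * (-1) ^ (m + j) * (sqrt (\<rho> m) / sqrt (\<rho> j)))"
  shows "lanczos_T A b x0 (Suc m) *\<^sub>v x = unit_vec (Suc m) m"
    and "x \<bullet> x = (\<gamma> m)\<^sup>2 * \<rho> m * (\<Sum>j\<le>m. 1 / \<rho> j)"
proof -
  have xc: "x \<in> carrier_vec (Suc m)" by (simp add: x_def)
  have pos: "0 < sqrt (\<rho> j)" "0 < \<gamma> j" "\<rho> j = (sqrt (\<rho> j))\<^sup>2" if "j \<le> m" for j
    using rho_pos[OF nz[OF that]] gamma_pos[OF nz[OF that]] by simp_all
  have xj: "x $ j = \<gamma> m * (-1) ^ (m + j) * (sqrt (\<rho> m) / sqrt (\<rho> j))" if "j \<le> m" for j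
    using that by (simp add: x_def)
  \<comment> \<open>Each diagonal entry of T is split into its two summands, one paired with each
    neighbour. Both \<open>lower\<close> and \<open>upper\<close> are multiples of an entry of
    \<open>L\<^sup>T x\<close> of the form \<open>x $ (i - 1) + sqrt (\<delta> i) * x $ i\<close>,
    which vanishes by the alternating signs.\<close>
  have lower: "lanczos_beta A b x0 i * x $ (i - 1) + (\<delta> i / \<gamma> (i - 1)) * x $ i = 0"
    if i: "i \<le> m" "0 < i" for i
  proof -
    obtain i' where i': "i = Suc i'" using i(2) gr0_conv_Suc by blast
    define u w where "u = sqrt (\<rho> i')" and "w = sqrt (\<rho> i)"
    then have "\<rho> i' = u * u" "\<rho> i = w * w" "0 < u" "0 < w" "0 < \<gamma> i'"
      using i pos[of i] pos[of i'] by (simp_all add: i' flip: power2_eq_square)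
    then show ?thesis
      using i xj[of i] xj[of i']
      by (simp add: i' beta_Suc delta_Suc real_sqrt_divide field_simps)
  qed
  have upper: "(1 / \<gamma> i) * x $ i + lanczos_beta A b x0 (Suc i) * x $ Suc i = 0" if "i < m" for i
    using that pos[of i] pos[of "Suc i"] xj[of i] xj[of "Suc i"]
    by (simp add: beta_Suc delta_Suc real_sqrt_divide field_simps power2_eq_square)
  \<comment> \<open>In the last row \<open>1 / \<gamma> m\<close> has no right neighbour to cancel
    it; the factor \<open>\<gamma> m\<close> in \<open>x\<close> scales what remains to 1.\<close>
  have last: "(1 / \<gamma> m) * x $ m = 1"
    using pos[of m] xj[of m] by (simp add: field_simps flip: mult_2)
  show "lanczos_T A b x0 (Suc m) *\<^sub>v x = unit_vec (Suc m) m"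
  proof (rule eq_vecI)
    fix i assume "i < dim_vec (unit_vec (Suc m) m :: real vec)"
    then have i: "i < Suc m" by simp
    have "(lanczos_T A b x0 (Suc m) *\<^sub>v x) $ i =
      (if 0 < i then lanczos_beta A b x0 i * x $ (i - 1) + (\<delta> i / \<gamma> (i - 1)) * x $ i else 0)
      + ((1 / \<gamma> i) * x $ i + (if i < m then lanczos_beta A b x0 (Suc i) * x $ Suc i else 0))"
      unfolding lanczos_T_def sym_tridiag_mult_vec[OF xc i] alpha_Suc by (simp add: algebra_simps)
    also have "\<dots> = unit_vec (Suc m) m $ i"
      using lower[of i] upper[of i] last i by (cases "i = m") auto
    finally show "(lanczos_T A b x0 (Suc m) *\<^sub>v x) $ i = unit_vec (Suc m) m $ i" .
  qed (simp add: lanczos_T_def sym_tridiag_def)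
  have "x \<bullet> x = (\<Sum>j\<le>m. x $ j * x $ j)"
    by (simp add: scalar_prod_def x_def atLeast0LessThan lessThan_Suc_atMost)
  also have "\<dots> = (\<gamma> m)\<^sup>2 * \<rho> m * (\<Sum>j\<le>m. 1 / \<rho> j)"
    unfolding sum_distrib_left
  proof (rule sum.cong)
    fix j assume "j \<in> {..m}"
    then have j: "j \<le> m" by simp
    have "x $ j * x $ j = (\<gamma> m)\<^sup>2 * ((-1) ^ (m + j))\<^sup>2 * ((sqrt (\<rho> m))\<^sup>2 / (sqrt (\<rho> j))\<^sup>2)"
      by (simp add: xj[OF j] power_mult_distrib power_divide flip: power2_eq_square del: real_sqrt_pow2_iff)
    then show "x $ j * x $ j = (\<gamma> m)\<^sup>2 * \<rho> m * (1 / \<rho> j)"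
      by (simp add: rho_nonneg flip: power_mult)
  qed simp
  finally show "x \<bullet> x = \<dots>" .
qed

section \<open>The bidiagonal factorization and the modified coefficient\<close>

lemma cg_L_row_sum:
  assumes "i < Suc k"
  shows "(\<Sum>l<Suc k. cg_L A b x0 k $$ (i, l) * f l) =
    f i + (if 0 < i then sqrt (\<delta> i) * f (i - 1) else 0)"
proof -
  have "(\<Sum>l<Suc k. cg_L A b x0 k $$ (i, l) * f l) = (\<Sum>l<Suc k. (if l = i then f i else 0)
      + (if l = i - 1 then if 0 < i then sqrt (\<delta> i) * f (i - 1) else 0 else 0))"
    using assms by (intro sum.cong) (auto simp: cg_L_def)
  then show ?thesis
    using assms by (simp add: sum.distrib less_imp_diff_less del: sum.lessThan_Suc)
qed

text \<open>The diagonal \<open>d\<close> stays arbitrary because its last entry is the unknown of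
  \<open>gamma_mu\<close>. Nonnegativity of \<open>\<delta>\<close> turns the squared square roots
  on the diagonal back into \<open>\<delta>\<close>.\<close>

lemma cg_LDL:
  "cg_L A b x0 k * mat_diag (k + 1) d * transpose_mat (cg_L A b x0 k) =
    sym_tridiag (k + 1) (\<lambda>j. d (j - 1) + (if 1 < j then \<delta> (j - 1) * d (j - 2) else 0))
      (\<lambda>j. sqrt (\<delta> j) * d (j - 1))"
    (is "?L * ?D * ?LT = ?T")
proof (rule eq_matI)
  have L: "?L \<in> carrier_mat (k + 1) (k + 1)" by (simp add: cg_L_def)
  fix i j assume "i < dim_row ?T" "j < dim_col ?T"
  then have ij: "i < Suc k" "j < Suc k" by (simp_all add: sym_tridiag_def)
  have "(?L * ?D * ?LT) $$ (i, j) = (\<Sum>l<Suc k. ?L $$ (i, l) * (d l * ?L $$ (j, l)))"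
    unfolding mat_diag_mult_right[OF L] using L ij
    by (simp add: scalar_prod_def atLeast0LessThan mult.assoc del: sum.lessThan_Suc)
  also have "\<dots> = ?T $$ (i, j)"
    unfolding cg_L_row_sum[OF ij(1)] using ij
    by (auto simp: cg_L_def sym_tridiag_def delta_nonneg numeral_2_eq_2)
  finally show "(?L * ?D * ?LT) $$ (i, j) = ?T $$ (i, j)" .
qed (simp_all add: cg_L_def sym_tridiag_def)

text \<open>The Lanczos coefficients are exactly the entries of the product in
  \<open>cg_LDL\<close>, so both sides agree automatically except in the last diagonal
  entry.\<close>

lemma modified_T_factorization_iff:
  "modified_T A b x0 (Suc m) a =
     cg_L A b x0 (Suc m) * mat_diag (Suc m + 1) (\<lambda>i. inverse (if i = Suc m then g else \<gamma> i))
       * transpose_mat (cg_L A b x0 (Suc m))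
   \<longleftrightarrow> inverse g = a - \<delta> (Suc m) / \<gamma> m" (is "?T = ?F \<longleftrightarrow> _")
proof
  assume "?T = ?F"
  then have "?T $$ (Suc m, Suc m) = ?F $$ (Suc m, Suc m)" by simp
  then show "inverse g = a - \<delta> (Suc m) / \<gamma> m"
    unfolding cg_LDL by (simp add: modified_T_def sym_tridiag_def numeral_2_eq_2 divide_inverse)
next
  assume "inverse g = a - \<delta> (Suc m) / \<gamma> m"
  then show "?T = ?F"
    unfolding cg_LDL modified_T_def
    by (intro eq_matI)
      (auto simp: sym_tridiag_def alpha_Suc beta_Suc numeral_2_eq_2 divide_inverse)
qed

text \<open>A nonzero last pivot has exactly one nonzero \<open>g\<close> as its reciprocal; for a
  zero pivot the description in \<open>gamma_mu\<close> would have no solution.\<close>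

lemma inverse_gamma_mu:
  assumes "alpha_mu A b x0 (Suc m) \<mu> \<noteq> \<delta> (Suc m) / \<gamma> m"
  shows "inverse (gamma_mu A b x0 (Suc m) \<mu>) = alpha_mu A b x0 (Suc m) \<mu> - \<delta> (Suc m) / \<gamma> m"
proof -
  let ?c = "alpha_mu A b x0 (Suc m) \<mu> - \<delta> (Suc m) / \<gamma> m"
  have "gamma_mu A b x0 (Suc m) \<mu> = inverse ?c"
    unfolding gamma_mu_def modified_T_factorization_iff
    using assms by (intro the_equality) (simp_all, metis inverse_inverse_eq)
  then show ?thesis by simp
qed

end

section \<open>Assembling the moments into the identity\<close>

theorem theorem1:
  fixes A S :: "real mat" and b x0 :: "real vec" and N k :: nat
    and lam \<theta> :: "nat \<Rightarrow> real" and \<mu> :: real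
  assumes spd: "sym_pos_def N A"
    and simple_eigenvalues: "strict_mono_on {1..N} lam"
      "char_poly A = (\<Prod>i\<in>{1..N}. [:- lam i, 1:])"
    and b: "b \<in> carrier_vec N" and x0: "x0 \<in> carrier_vec N"
    and r0: "b - A *\<^sub>v x0 \<noteq> 0\<^sub>v N"
    and k: "1 \<le> k" "k < vec_space.grade N A (b - A *\<^sub>v x0)"
    and spectral: "orthonormal_mat k S" "strict_mono_on {1..k} \<theta>"
      "lanczos_T A b x0 k = S * mat_diag k (\<lambda>i. \<theta> (i + 1)) * transpose_mat S"
    and mu: "0 < \<mu>" "\<mu> < \<theta> 1"
  shows "inverse (gamma_mu A b x0 k \<mu>) =
    \<mu> / cg_phi A b x0 k + (\<Sum>i=1..k. (\<mu> / \<theta> i)\<^sup>2 * eta A b x0 S \<theta> k \<mu> i)"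
proof -
  interpret cg_iteration N A b x0
    using spd b x0 by unfold_locales
  obtain m where km: "k = Suc m" using k(1) by (cases k) auto
  have nz: "r j \<noteq> 0\<^sub>v N" if "j \<le> k" for j
    using r_nonzero[of j] k(2) that by (simp add: r_0)
  have pos: "0 < \<rho> m" "0 < \<rho> k" "0 < \<gamma> m"
    using nz by (auto simp: km intro: rho_pos gamma_pos)
  have theta: "\<mu> < \<theta> (i + 1)" "0 < \<theta> (i + 1)" if "i < k" for i
  proof -
    have "\<theta> 1 \<le> \<theta> (i + 1)"
      using that spectral(2) by (cases "i = 0") (auto simp: strict_mono_on_def intro!: less_imp_le)
    then show "\<mu> < \<theta> (i + 1)" "0 < \<theta> (i + 1)" using mu by simp_all
  qed
  define s where "s i = S $$ (m, i)" for i
  define \<beta> where "\<beta> = lanczos_beta A b x0 k"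
  define E where "E = (\<Sum>i<k. (\<beta> * s i)\<^sup>2 / (\<theta> (i + 1) - \<mu>))"
  have beta2: "\<beta>\<^sup>2 = \<rho> k / (\<rho> m * (\<gamma> m)\<^sup>2)"
    using pos by (simp add: \<beta>_def km beta_Suc delta_Suc power_divide rho_nonneg)
  have alpha: "alpha_mu A b x0 k \<mu> = \<mu> + E"
    unfolding alpha_mu_def modified_T_def
    using eigenvalue_bordered_tridiag_iff[OF spectral(1) km spectral(3)[unfolded lanczos_T_def], of \<mu>]
      theta(1) by (intro the_equality) (auto simp: E_def \<beta>_def s_def less_le)
  obtain x where x: "x \<in> carrier_vec k" "lanczos_T A b x0 k *\<^sub>v x = unit_vec k m"
      "x $ m = \<gamma> m" "x \<bullet> x = (\<gamma> m)\<^sup>2 * \<rho> m * (\<Sum>j\<le>m. 1 / \<rho> j)"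
  proof
    let ?x = "vec k (\<lambda>j. \<gamma> m * (-1) ^ (m + j) * (sqrt (\<rho> m) / sqrt (\<rho> j)))"
    show "?x \<in> carrier_vec k" by simp
    show "lanczos_T A b x0 k *\<^sub>v ?x = unit_vec k m"
      "?x \<bullet> ?x = (\<gamma> m)\<^sup>2 * \<rho> m * (\<Sum>j\<le>m. 1 / \<rho> j)"
      using lanczos_T_solution[of m] nz by (auto simp: km)
    show "?x $ m = \<gamma> m" using pos by (simp add: km flip: mult_2)
  qed
  \<comment> \<open>The linear system is brought into the form required by
    \<open>spectral_resolvent\<close>, with shift 0 and \<open>c = 1\<close>.\<close>
  have "(S * mat_diag k (\<lambda>i. \<theta> (i + 1)) * transpose_mat S) *\<^sub>v x = 0\<^sub>v k + unit_vec k m"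
    using x(1,2) unfolding spectral(3) by simp
  moreover have "0 \<cdot>\<^sub>v x = 0\<^sub>v k" using x(1) by auto
  ultimately have "(S * mat_diag k (\<lambda>i. \<theta> (i + 1)) * transpose_mat S) *\<^sub>v x
      = 0 \<cdot>\<^sub>v x + 1 \<cdot>\<^sub>v unit_vec k m"
    by simp
  from spectral_resolvent[OF spectral(1) _ _ x(1) this] theta(2)
  have "(\<Sum>i<k. (s i)\<^sup>2 / \<theta> (i + 1)) = \<gamma> m"
    and "(\<Sum>i<k. (s i)\<^sup>2 / (\<theta> (i + 1))\<^sup>2) = (\<gamma> m)\<^sup>2 * \<rho> m * (\<Sum>j\<le>m. 1 / \<rho> j)"
    by (simp_all add: km x(3,4) s_def less_le)
  \<comment> \<open>Multiplied by \<open>\<beta>\<^sup>2\<close>, the first moment becomes the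
    correction subtracted from \<open>alpha_mu\<close>, and the second becomes the sum in
    \<open>inverse_phi\<close> without its leading 1.\<close>
  then have F: "\<beta>\<^sup>2 * (\<Sum>i<k. (s i)\<^sup>2 / \<theta> (i + 1)) = \<delta> k / \<gamma> m"
    "\<beta>\<^sup>2 * (\<Sum>i<k. (s i)\<^sup>2 / (\<theta> (i + 1))\<^sup>2) = 1 / cg_phi A b x0 k - 1"
    using inverse_phi[of m] nz pos
    by (simp_all only: beta2) (simp_all add: km delta_Suc power2_eq_square)
  have summand: "(\<mu> / t)\<^sup>2 * ((\<beta> * u)\<^sup>2 / (t - \<mu>)) =
      (\<beta> * u)\<^sup>2 / (t - \<mu>) - \<beta>\<^sup>2 * (u\<^sup>2 / t) - \<mu> * (\<beta>\<^sup>2 * (u\<^sup>2 / t\<^sup>2))"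
    if "\<mu> < t" for t u
    using that mu(1) by (simp add: divide_simps power2_eq_square) (simp add: algebra_simps)
  have "(\<Sum>i=1..k. (\<mu> / \<theta> i)\<^sup>2 * eta A b x0 S \<theta> k \<mu> i)
      = (\<Sum>i<k. (\<mu> / \<theta> (i + 1))\<^sup>2 * ((\<beta> * s i)\<^sup>2 / (\<theta> (i + 1) - \<mu>)))"
    by (simp add: sum.atLeast1_atMost_eq eta_def \<beta>_def s_def km)
  also have "\<dots> = E - \<beta>\<^sup>2 * (\<Sum>i<k. (s i)\<^sup>2 / \<theta> (i + 1)) - \<mu> * (\<beta>\<^sup>2 * (\<Sum>i<k. (s i)\<^sup>2 / (\<theta> (i + 1))\<^sup>2))"
    unfolding E_def sum_distrib_left sum_subtractf[symmetric]
    by (intro sum.cong summand theta(1)) auto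
  also have "\<dots> = E - \<delta> k / \<gamma> m - \<mu> * (1 / cg_phi A b x0 k - 1)"
    unfolding F ..
  \<comment> \<open>The \<open>- 1\<close> of the second moment contributes \<open>+ \<mu>\<close>,
    which completes \<open>E\<close> to \<open>alpha_mu\<close>.\<close>
  finally have rhs: "\<mu> / cg_phi A b x0 k + (\<Sum>i=1..k. (\<mu> / \<theta> i)\<^sup>2 * eta A b x0 S \<theta> k \<mu> i)
      = alpha_mu A b x0 k \<mu> - \<delta> k / \<gamma> m"
    by (simp add: alpha algebra_simps)
  \<comment> \<open>Positivity of the right-hand side shows that the last pivot is nonzero, as
    \<open>inverse_gamma_mu\<close> requires.\<close>
  have "0 < \<mu> / cg_phi A b x0 k"
    using rho_pos[OF nz, of k] p_norm[of k] nz p_nonzero[of k] p_carrier[of k]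
      real_scalar_prod_self[of "p k"] mu(1)
    by (auto simp: cg_phi_def less_le)
  moreover have "0 \<le> (\<Sum>i=1..k. (\<mu> / \<theta> i)\<^sup>2 * eta A b x0 S \<theta> k \<mu> i)"
  proof (intro sum_nonneg mult_nonneg_nonneg)
    fix i assume "i \<in> {1..k}"
    then have "i - 1 < k" "i - 1 + 1 = i" by auto
    then have "\<mu> < \<theta> i" using theta(1)[of "i - 1"] by simp
    then show "0 \<le> eta A b x0 S \<theta> k \<mu> i" by (simp add: eta_def)
  qed simp
  ultimately have "alpha_mu A b x0 k \<mu> \<noteq> \<delta> k / \<gamma> m"
    using rhs by linarith
  then show ?thesis
    using inverse_gamma_mu[of m \<mu>] rhs by (simp add: km)
qed

end
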